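(* Let $p_1(\cdot),p_2(\cdot)$ be variable exponents on $\mathbb{R}^n$ with values in $[1,\infty]$ and $p_3(\cdot)$ a variable exponent on $\mathbb{R}^n$ with $0<p_3(\cdot)\le\infty$, and suppose that $|\Omega^i_\infty|=0$ for $i=1,2,3$, where $\Omega^i_\infty=\{x\in\mathbb{R}^n:p_i(x)=\infty\}$. Suppose that there is a non-zero continuous integrable function $M$ on $\mathbb{R}^n$ such that $M\in\tilde{BM}(\mathbb{R}^{2n})(p_1(\cdot),p_2(\cdot),p_3(\cdot))$. Then $$\frac1{(p_3)_+}\le\frac1{(p_1)_-}+\frac1{(p_2)_-}.$$
   Context: Variable Lebesgue spaces. For a measurable exponent $p(\cdot)$ on $\mathbb{R}^n$ put $p_-=\operatorname{ess\,inf}p(x)$, $p_+=\operatorname{ess\,sup}p(x)$ (with $1/\infty=0$). If $1\le p(\cdot)\le\infty$, let $\Omega_\infty=\{x:p(x)=\infty\}$ and $$\rho_{p(\cdot)}(f)=\int_{\mathbb{R}^n\setminus\Omega_\infty}|f(x)|^{p(x)}dx+\|f\|_{L^\infty(\Omega_\infty)};$$ $L^{p(\cdot)}$ is the set of measurable $f$ with $\rho_{p(\cdot)}(f/\lambda)<\infty$ for some $\lambda>0$, with $\|f\|_{p(\cdot)}=\inf\{\lambda>0:\rho_{p(\cdot)}(f/\lambda)\le1\}$. If $0<p_-\le p_+<\infty$ (the class $\mathcal{P}^0(\mathbb{R}^n)$), $L^{p(\cdot)}$ is the set of $f$ with $|f|^{p_0}\in L^{p(\cdot)/p_0}$ for some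 $0<p_0<p_-$, with quasi-norm $\|f\|_{p(\cdot)}=\||f|^{p_0}\|_{p(\cdot)/p_0}^{1/p_0}$. The third exponent $p_3(\cdot)$ is one for which the space is defined in one of these two ways. Bilinear multipliers. Given a function $M$ on $\mathbb{R}^n$, let $$B_M(f,g)(x)=\int_{\mathbb{R}^{2n}}\hat f(\xi)\hat g(\eta)M(\xi-\eta)e^{2\pi i\langle\xi+\eta,x\rangle}\,d\xi\,d\eta$$ for $f,g$ such that $\hat f,\hat g$ are bounded and compactly supported. One says $M\in\tilde{BM}(\mathbb{R}^{2n})(p_1(\cdot),p_2(\cdot),p_3(\cdot))$ if $B_M$ extends to a bounded bilinear operator $L^{p_1(\cdot)}\times L^{p_2(\cdot)}\to L^{p_3(\cdot)}$, that is, there is $C>0$ with $\|B_M(f,g)\|_{p_3(\cdot)}\le C\|f\|_{p_1(\cdot)}\|g\|_{p_2(\cdot)}$ for all such $f,g$. *)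

theory Defs
  imports "HOL-Analysis.Analysis" "HOL-Probability.Essential_Supremum"
begin

section \<open>Variable Lebesgue spaces\<close>

text \<open>
  Exponents are extended nonnegative functions, so that the value \<^term>\<open>\<infinity>\<close> is allowed and
  \<^prop>\<open>1 / (\<infinity>::ennreal) = 0\<close>. Measurability always refers to the Lebesgue sigma-algebra.
\<close>

definition essinf :: "'a measure \<Rightarrow> ('a \<Rightarrow> ennreal) \<Rightarrow> ennreal" where
  "essinf M f = Sup {c. AE x in M. c \<le> f x}"

definition infinity_set :: "('a \<Rightarrow> ennreal) \<Rightarrow> 'a set" where
  "infinity_set p = {x. p x = \<infinity>}"

definition modular :: "('a::euclidean_space \<Rightarrow> ennreal) \<Rightarrow> ('a \<Rightarrow> 'b::real_normed_vector) \<Rightarrow> ennreal" where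
  "modular p f =
     (\<integral>\<^sup>+ x \<in> - infinity_set p. ennreal (norm (f x) powr enn2real (p x)) \<partial>lebesgue)
     + esssup (restrict_space lebesgue (infinity_set p)) (\<lambda>x. ennreal (norm (f x)))"

definition lux_space :: "('a::euclidean_space \<Rightarrow> ennreal) \<Rightarrow> ('a \<Rightarrow> 'b::real_normed_vector) set" where
  "lux_space p =
     {f \<in> borel_measurable lebesgue. \<exists>c>0. modular p (\<lambda>x. f x /\<^sub>R c) < \<infinity>}"

definition lux_norm :: "('a::euclidean_space \<Rightarrow> ennreal) \<Rightarrow> ('a \<Rightarrow> 'b::real_normed_vector) \<Rightarrow> real" where
  "lux_norm p f = Inf {c. c > 0 \<and> modular p (\<lambda>x. f x /\<^sub>R c) \<le> 1}"

definition exponent_ge_1 :: "('a::euclidean_space \<Rightarrow> ennreal) \<Rightarrow> bool" where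
  "exponent_ge_1 p \<longleftrightarrow> p \<in> borel_measurable lebesgue \<and> (\<forall>x. 1 \<le> p x)"

definition exponent_P0 :: "('a::euclidean_space \<Rightarrow> ennreal) \<Rightarrow> bool" where
  "exponent_P0 p \<longleftrightarrow>
     p \<in> borel_measurable lebesgue \<and> 0 < essinf lebesgue p \<and> esssup lebesgue p < \<infinity>"

text \<open>
  For an exponent in the second class the quasi-norm is computed with some admissible \<open>p\<^sub>0\<close>.
  The value does not depend on it: since \<open>p\<close> is finite almost everywhere, replacing \<open>c\<close> by
  \<open>c powr p\<^sub>0\<close> gives \<open>Inf {c. c > 0 \<and> modular p (\<lambda>x. f x /\<^sub>R c) \<le> 1}\<close> in every case. For the same reason the two clauses
  of the definitions agree on the exponents that belong to both classes.
\<close>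

definition admissible_power :: "('a::euclidean_space \<Rightarrow> ennreal) \<Rightarrow> real \<Rightarrow> bool" where
  "admissible_power p p\<^sub>0 \<longleftrightarrow> 0 < p\<^sub>0 \<and> ennreal p\<^sub>0 < essinf lebesgue p"

definition var_Lp :: "('a::euclidean_space \<Rightarrow> ennreal) \<Rightarrow> ('a \<Rightarrow> complex) set" where
  "var_Lp p =
     (if exponent_ge_1 p then lux_space p
      else {f \<in> borel_measurable lebesgue.
              \<exists>p\<^sub>0. admissible_power p p\<^sub>0 \<and>
                (\<lambda>x. norm (f x) powr p\<^sub>0) \<in> lux_space (\<lambda>x. p x / ennreal p\<^sub>0)})"

definition var_Lp_norm :: "('a::euclidean_space \<Rightarrow> ennreal) \<Rightarrow> ('a \<Rightarrow> complex) \<Rightarrow> real" where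
  "var_Lp_norm p f =
     (if exponent_ge_1 p then lux_norm p f
      else (let p\<^sub>0 = (SOME p\<^sub>0. admissible_power p p\<^sub>0)
            in lux_norm (\<lambda>x. p x / ennreal p\<^sub>0) (\<lambda>x. norm (f x) powr p\<^sub>0) powr (1 / p\<^sub>0)))"


section \<open>The Fourier transform\<close>

definition fourier_L1 :: "('a::euclidean_space \<Rightarrow> complex) \<Rightarrow> 'a \<Rightarrow> complex" where
  "fourier_L1 f \<xi> = (LINT x|lebesgue. f x * exp (- 2 * of_real pi * \<i> * of_real (x \<bullet> \<xi>)))"

definition L2_functions :: "('a::euclidean_space \<Rightarrow> complex) set" where
  "L2_functions =
     {f \<in> borel_measurable lebesgue. integrable lebesgue (\<lambda>x. (norm (f x))\<^sup>2)}"

definition L2_dist_sq :: "('a::euclidean_space \<Rightarrow> complex) \<Rightarrow> ('a \<Rightarrow> complex) \<Rightarrow> real" where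
  "L2_dist_sq f g = (LINT x|lebesgue. (norm (f x - g x))\<^sup>2)"

text \<open>
  \<open>fourier_L2 f F\<close>: \<open>F\<close> is (a representative of) the Fourier transform of \<open>f\<close> in the sense of
  \<open>L\<^sup>2\<close>, i.e. the continuous extension of the integral formula from \<open>L\<^sup>1 \<inter> L\<^sup>2\<close>. A function whose
  Fourier transform is bounded with compact support lies in \<open>L\<^sup>2\<close> but need not be integrable,
  so the integral formula alone would not cover all functions to which bilinear multipliers are
  applied.
\<close>

definition fourier_L2 :: "('a::euclidean_space \<Rightarrow> complex) \<Rightarrow> ('a \<Rightarrow> complex) \<Rightarrow> bool" where
  "fourier_L2 f F \<longleftrightarrow>
     f \<in> L2_functions \<and> F \<in> L2_functions \<and>
     (\<exists>h :: nat \<Rightarrow> 'a \<Rightarrow> complex.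
        (\<forall>k. integrable lebesgue (h k) \<and> h k \<in> L2_functions \<and> fourier_L1 (h k) \<in> L2_functions) \<and>
        (\<lambda>k. L2_dist_sq (h k) f) \<longlonglongrightarrow> 0 \<and>
        (\<lambda>k. L2_dist_sq (fourier_L1 (h k)) F) \<longlonglongrightarrow> 0)"

definition bounded_compact_support :: "('a::euclidean_space \<Rightarrow> complex) \<Rightarrow> bool" where
  "bounded_compact_support F \<longleftrightarrow>
     bounded (range F) \<and> (\<exists>K. compact K \<and> (\<forall>\<xi>. \<xi> \<notin> K \<longrightarrow> F \<xi> = 0))"


section \<open>Bilinear multipliers\<close>

text \<open>
  The operator \<open>B\<^sub>M\<close> depends on \<open>f\<close> and \<open>g\<close> only through their Fourier transforms, which are the
  arguments \<open>F\<close> and \<open>G\<close> here.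
\<close>

definition bilinear_mult ::
    "('a::euclidean_space \<Rightarrow> complex) \<Rightarrow> ('a \<Rightarrow> complex) \<Rightarrow> ('a \<Rightarrow> complex) \<Rightarrow> 'a \<Rightarrow> complex" where
  "bilinear_mult M F G x =
     (LINT (\<xi>, \<eta>)|lebesgue.
        F \<xi> * G \<eta> * M (\<xi> - \<eta>) * exp (2 * of_real pi * \<i> * of_real ((\<xi> + \<eta>) \<bullet> x)))"

definition BM_tilde ::
    "('a::euclidean_space \<Rightarrow> ennreal) \<Rightarrow> ('a \<Rightarrow> ennreal) \<Rightarrow> ('a \<Rightarrow> ennreal) \<Rightarrow> ('a \<Rightarrow> complex) set" where
  "BM_tilde p1 p2 p3 =
     {M. \<exists>C>0. \<forall>f g F G.
        f \<in> var_Lp p1 \<and> g \<in> var_Lp p2 \<and>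
        fourier_L2 f F \<and> bounded_compact_support F \<and>
        fourier_L2 g G \<and> bounded_compact_support G \<longrightarrow>
          bilinear_mult M F G \<in> var_Lp p3 \<and>
          var_Lp_norm p3 (bilinear_mult M F G) \<le> C * var_Lp_norm p1 f * var_Lp_norm p2 g}"

end

theory Submission
  imports Defs "HOL-Probability.Sinc_Integral"
begin

text \<open>
  The inequality is a scaling argument on wave packets. Let \<open>n\<close> be the dimension, let
  \<open>M \<xi>\<^sub>0 \<noteq> 0\<close>, and let \<open>\<phi>\<close> be an integrable function with values in \<open>[0, 1]\<close> whose Fourier
  transform is nonnegative, continuous, compactly supported and positive at the origin. Put
  \<open>f x = exp (2 \<pi> \<i> (x \<bullet> \<xi>\<^sub>0)) \<phi> (x / R)\<close> and \<open>g x = \<phi> (x / R)\<close> for large \<open>R\<close>.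

  The transforms of \<open>f\<close> and \<open>g\<close> live at distance \<open>O(1 / R)\<close> from \<open>\<xi>\<^sub>0\<close> and from \<open>0\<close>. There
  \<open>M (\<xi> - \<eta>)\<close> is close to \<open>M \<xi>\<^sub>0\<close> by continuity, and for \<open>\<bar>x\<bar> \<le> \<epsilon> R\<close> the phase
  \<open>exp (2 \<pi> \<i> ((\<xi> + \<eta>) \<bullet> x))\<close> is nearly constant, so \<open>B\<^sub>M (f, g)\<close> stays above some \<open>\<delta> > 0\<close>,
  independent of \<open>R\<close>, on the ball of radius \<open>\<epsilon> R\<close> (\<open>bilinear_mult_lower\<close>).

  On the side of the norms, a function bounded by 1 with integral \<open>O(R^n)\<close> has norm
  \<open>O(R powr (n / (p\<^sub>i)\<^sub>-))\<close> (\<open>lux_upper\<close>), while a function that is at least \<open>\<delta>\<close> on a set of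
  measure \<open>c R^n\<close> has norm at least a constant times \<open>R powr (n / (p\<^sub>3)\<^sub>+)\<close>
  (\<open>var_Lp_norm_lower\<close>). Boundedness of \<open>B\<^sub>M\<close> therefore gives
  \<open>R powr (n / (p\<^sub>3)\<^sub>+) = O(R powr (n / (p\<^sub>1)\<^sub>- + n / (p\<^sub>2)\<^sub>-))\<close>, and \<open>R \<rightarrow> \<infinity>\<close> compares the
  exponents.

  For \<open>\<phi>\<close> a tensor product of the functions \<open>(1 - cos t) / t\<^sup>2\<close> is taken. Their transforms are
  computed directly: the product formula for cosines reduces everything to
  \<open>\<integral> (1 - cos (s t)) / t\<^sup>2 dt\<close>, which is \<open>\<bar>s\<bar>\<close> times a positive constant by scaling alone.
\<close>

section \<open>Norm bounds from the modular\<close>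

text \<open>
  The supremum defining \<open>essinf\<close> is reached along a sequence, so only countably many null sets
  are discarded.
\<close>

lemma AE_essinf_le: "AE x in M. essinf M f \<le> f x"
proof -
  let ?A = "{c. AE x in M. c \<le> f x}"
  have "0 \<in> ?A" by simp
  then obtain s :: "nat \<Rightarrow> ennreal" where s: "range s \<subseteq> ?A" "Sup ?A = (SUP i. s i)"
    using ennreal_Sup_countable_SUP[of ?A] by blast
  have "AE x in M. \<forall>i. s i \<le> f x"
    using s(1) by (subst AE_all_countable) auto
  then show ?thesis
    unfolding essinf_def s(2) by eventually_elim (auto intro: SUP_least)
qed

text \<open>
  For an exponent that is finite almost everywhere the modular is a single integral: the part
  at infinity is an essential supremum over a null set.
\<close>

lemma modular_dilate:
  fixes h :: "'a::euclidean_space \<Rightarrow> 'b::real_normed_vector"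
  assumes "infinity_set p \<in> null_sets lebesgue" "h \<in> borel_measurable lebesgue" "c > 0"
  shows "modular p (\<lambda>x. h x /\<^sub>R c)
       = (\<integral>\<^sup>+ x. ennreal ((norm (h x) / c) powr enn2real (p x)) \<partial>lebesgue)"
proof -
  let ?S = "infinity_set p"
  have notin: "AE x in lebesgue. x \<notin> ?S"
    using assms(1) by (rule AE_not_in)
  have S: "?S \<in> sets lebesgue" using assms(1) by auto
  let ?N = "restrict_space lebesgue ?S"
  have meas: "(\<lambda>x. ennreal (norm (h x /\<^sub>R c))) \<in> borel_measurable ?N"
    using assms(2) by (intro measurable_restrict_space1) measurable
  have "AE x in ?N. False"
    using notin S by (subst AE_restrict_space_iff) auto
  then have "esssup ?N (\<lambda>x. ennreal (norm (h x /\<^sub>R c))) \<le> 0"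
    by (intro esssup_I[OF meas]) (rule eventually_mono, assumption, blast)
  then have "esssup ?N (\<lambda>x. ennreal (norm (h x /\<^sub>R c))) = 0" by simp
  moreover have "(\<integral>\<^sup>+ x \<in> - ?S. ennreal (norm (h x /\<^sub>R c) powr enn2real (p x)) \<partial>lebesgue)
      = (\<integral>\<^sup>+ x. ennreal ((norm (h x) / c) powr enn2real (p x)) \<partial>lebesgue)"
    using notin assms(3)
    by (intro nn_integral_cong_AE) (auto simp: divide_inverse mult.commute elim!: eventually_mono)
  ultimately show ?thesis unfolding modular_def by simp
qed

lemma lux_norm_le:
  assumes "c > 0" "modular p (\<lambda>x. h x /\<^sub>R c) \<le> 1"
  shows "lux_norm p h \<le> c"
  unfolding lux_norm_def using assms by (intro cInf_lower bdd_belowI[of _ 0]) auto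

text \<open>
  The test value is \<open>c = V powr (1/a)\<close>. Since \<open>c \<ge> 1\<close> and \<open>norm h \<le> 1\<close>, the quotient
  \<open>norm h / c\<close> is at most 1 and its powers decrease in the exponent: first \<open>p x\<close> may be lowered
  to \<open>a\<close>, which produces the factor \<open>1 / V\<close>, and then the remaining power \<open>a\<close> of \<open>norm h\<close> to 1.
\<close>

lemma lux_upper:
  fixes h :: "'a::euclidean_space \<Rightarrow> 'b::real_normed_vector"
  assumes null: "infinity_set p \<in> null_sets lebesgue" and h: "h \<in> borel_measurable lebesgue"
    and a: "1 \<le> a" "AE x in lebesgue. ennreal a \<le> p x"
    and h1: "\<And>x. norm (h x) \<le> 1"
    and V: "1 \<le> V" "(\<integral>\<^sup>+ x. ennreal (norm (h x)) \<partial>lebesgue) \<le> ennreal V"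
  shows "h \<in> lux_space p" "0 \<le> lux_norm p h" "lux_norm p h \<le> V powr (1/a)"
proof -
  define c where "c = V powr (1/a)"
  have c1: "1 \<le> c" using V a by (simp add: c_def ge_one_powr_ge_zero)
  have ca: "c powr a = V" using V a by (simp add: c_def powr_powr)
  have fin: "AE x in lebesgue. p x < \<infinity>"
    using AE_not_in[OF null] by eventually_elim (simp add: infinity_set_def less_top)
  have "modular p (\<lambda>x. h x /\<^sub>R c) = (\<integral>\<^sup>+ x. ennreal ((norm (h x) / c) powr enn2real (p x)) \<partial>lebesgue)"
    using c1 by (intro modular_dilate[OF null h]) auto
  also have "\<dots> \<le> (\<integral>\<^sup>+ x. ennreal (norm (h x)) * ennreal (1/V) \<partial>lebesgue)"
  proof (rule nn_integral_mono_AE)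
    show "AE x in lebesgue. ennreal ((norm (h x) / c) powr enn2real (p x)) \<le> ennreal (norm (h x)) * ennreal (1/V)"
      using fin a(2)
    proof eventually_elim
      case (elim x)
      then have ap: "a \<le> enn2real (p x)"
        using a(1) by (cases "p x") (auto simp: ennreal_le_iff)
      have le1: "norm (h x) / c \<le> 1" using h1[of x] c1 by (simp add: divide_simps)
      have "(norm (h x) / c) powr enn2real (p x) \<le> (norm (h x) / c) powr a"
        using ap le1 c1 by (intro powr_mono') auto
      also have "\<dots> = norm (h x) powr a / V" by (simp add: powr_divide ca)
      also have "\<dots> \<le> norm (h x) powr 1 / V"
        using a h1[of x] V by (intro divide_right_mono powr_mono') auto
      also have "\<dots> = norm (h x) * (1/V)" by simp
      finally show ?case using V by (subst ennreal_mult[symmetric]) (auto intro: ennreal_leI)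
    qed
  qed
  also have "\<dots> = (\<integral>\<^sup>+ x. ennreal (norm (h x)) \<partial>lebesgue) * ennreal (1/V)"
    using h by (intro nn_integral_multc) measurable
  also have "\<dots> \<le> ennreal V * ennreal (1/V)" by (intro mult_right_mono V) auto
  also have "\<dots> = 1" using V by (simp add: ennreal_mult[symmetric])
  finally have m: "modular p (\<lambda>x. h x /\<^sub>R c) \<le> 1" .
  show "lux_norm p h \<le> V powr (1/a)" using lux_norm_le[OF _ m] c1 V by (simp add: c_def)
  show "0 \<le> lux_norm p h" unfolding lux_norm_def
    using m c1 by (intro cInf_greatest) (auto intro!: exI[of _ c])
  show "h \<in> lux_space p" unfolding lux_space_def
    using h m c1 by (auto intro!: exI[of _ c] le_less_trans[OF m])
qed

text \<open>
  Chebyshev's inequality with a variable exponent. With \<open>s = c / d\<close> the integrand is at least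
  \<open>(1/s) powr p x\<close> on \<open>E\<close>. If \<open>s \<ge> 1\<close> this is at least \<open>(1/s) powr P\<close>, which gives the claim.
  If \<open>s < 1\<close> it is at least 1, so the modular would be at least \<open>V > 1\<close>; this is where a set
  of measure larger than 1 is required.
\<close>

lemma lux_lower:
  fixes h :: "'a::euclidean_space \<Rightarrow> 'b::real_normed_vector"
  assumes null: "infinity_set p \<in> null_sets lebesgue" and h: "h \<in> borel_measurable lebesgue"
    and P: "0 < P" "AE x in lebesgue. p x \<le> ennreal P"
    and E: "E \<in> sets lebesgue" "emeasure lebesgue E = ennreal V" "1 < V"
    and d: "0 < d" "\<And>x. x \<in> E \<Longrightarrow> d \<le> norm (h x)"
    and c: "0 < c" "modular p (\<lambda>x. h x /\<^sub>R c) \<le> 1"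
  shows "d * V powr (1/P) \<le> c"
proof -
  define s where "s = c / d"
  have s0: "0 < s" using c d by (simp add: s_def)
  \<comment> \<open>The exponent that bounds \<open>(1/s) powr p x\<close> from below in either case.\<close>
  define Q where "Q = (if s \<ge> 1 then P else 0)"
  have "ennreal (V * (1/s) powr Q) = (\<integral>\<^sup>+ x. ennreal ((1/s) powr Q) * indicator E x \<partial>lebesgue)"
    using E by (subst nn_integral_cmult_indicator) (auto simp: ennreal_mult mult.commute)
  also have "\<dots> \<le> (\<integral>\<^sup>+ x. ennreal ((norm (h x) / c) powr enn2real (p x)) \<partial>lebesgue)"
  proof (rule nn_integral_mono_AE)
    show "AE x in lebesgue. ennreal ((1/s) powr Q) * indicator E x
         \<le> ennreal ((norm (h x) / c) powr enn2real (p x))"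
      using P(2)
    proof eventually_elim
      case (elim x)
      then have pP: "enn2real (p x) \<le> P" using P(1) by (intro enn2real_leI) auto
      show ?case
      proof (cases "x \<in> E")
        case True
        have "(1/s) powr Q \<le> (1/s) powr enn2real (p x)"
        proof (cases "s \<ge> 1")
          case True
          then show ?thesis using pP s0 by (auto simp: Q_def intro!: powr_mono')
        next
          case False
          then show ?thesis using s0 by (auto simp: Q_def intro!: ge_one_powr_ge_zero)
        qed
        also have "\<dots> \<le> (norm (h x) / c) powr enn2real (p x)"
          using d(2)[OF True] s0 c d(1) by (intro powr_mono2) (auto simp: s_def divide_right_mono)
        finally show ?thesis using True by (simp add: ennreal_leI)
      qed auto
    qed
  qed
  also have "\<dots> \<le> 1" using c modular_dilate[OF null h c(1)] by simp
  finally have le: "V * (1/s) powr Q \<le> 1" by simp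
  have "s \<ge> 1" using le E(3) s0 by (auto simp: Q_def split: if_splits)
  then have "V \<le> s powr P" using le s0 by (simp add: Q_def powr_divide divide_simps split: if_splits)
  then have "V powr (1/P) \<le> (s powr P) powr (1/P)" using E P by (intro powr_mono2) auto
  also have "\<dots> = s" using P s0 by (simp add: powr_powr)
  finally show ?thesis using d by (simp add: s_def field_simps)
qed

text \<open>
  A finite modular can be pushed below 1 by enlarging the dilation, because the exponent stays
  away from 0. Hence the infimum in \<open>lux_norm\<close> ranges over a nonempty set, without which no
  lower bound for it could be proved.
\<close>

lemma modular_le_1_nonempty:
  fixes h :: "'a::euclidean_space \<Rightarrow> 'b::real_normed_vector"
  assumes null: "infinity_set p \<in> null_sets lebesgue" and h: "h \<in> borel_measurable lebesgue"
    and pm: "p \<in> borel_measurable lebesgue"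
    and m: "0 < m" "AE x in lebesgue. ennreal m \<le> p x"
    and c: "0 < c" "modular p (\<lambda>x. h x /\<^sub>R c) < \<infinity>"
  shows "\<exists>c>0. modular p (\<lambda>x. h x /\<^sub>R c) \<le> 1"
proof -
  define T where "T = enn2real (modular p (\<lambda>x. h x /\<^sub>R c))"
  have T: "modular p (\<lambda>x. h x /\<^sub>R c) = ennreal T" "0 \<le> T" using c(2) by (auto simp: T_def)
  define K where "K = max 1 T powr (1/m)"
  have K: "1 \<le> K" "K powr m = max 1 T" using m by (auto simp: K_def powr_powr ge_one_powr_ge_zero)
  have fin: "AE x in lebesgue. p x < \<infinity>"
    using AE_not_in[OF null] by eventually_elim (simp add: infinity_set_def less_top)
  have cK: "0 < c * K" using c K by simp
  have "modular p (\<lambda>x. h x /\<^sub>R (c * K)) =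
     (\<integral>\<^sup>+ x. ennreal ((norm (h x) / (c * K)) powr enn2real (p x)) \<partial>lebesgue)"
    by (rule modular_dilate[OF null h cK])
  also have "\<dots> \<le> (\<integral>\<^sup>+ x. ennreal ((norm (h x) / c) powr enn2real (p x)) * ennreal (1 / max 1 T) \<partial>lebesgue)"
  proof (rule nn_integral_mono_AE)
    show "AE x in lebesgue. ennreal ((norm (h x) / (c * K)) powr enn2real (p x))
       \<le> ennreal ((norm (h x) / c) powr enn2real (p x)) * ennreal (1 / max 1 T)"
      using fin m(2)
    proof eventually_elim
      case (elim x)
      then have mp: "m \<le> enn2real (p x)"
        using m(1) by (cases "p x") (auto simp: ennreal_le_iff)
      have "(norm (h x) / (c * K)) powr enn2real (p x)
          = (norm (h x) / c) powr enn2real (p x) / K powr enn2real (p x)"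
        by (simp add: powr_divide powr_mult)
      also have "\<dots> \<le> (norm (h x) / c) powr enn2real (p x) / K powr m"
        using mp K by (intro divide_left_mono powr_mono) auto
      finally show ?case by (simp add: K ennreal_mult[symmetric] ennreal_leI)
    qed
  qed
  also have "\<dots> = (\<integral>\<^sup>+ x. ennreal ((norm (h x) / c) powr enn2real (p x)) \<partial>lebesgue) * ennreal (1 / max 1 T)"
  proof (rule nn_integral_multc)
    note [measurable] = h pm
    show "(\<lambda>x. ennreal ((norm (h x) / c) powr enn2real (p x))) \<in> borel_measurable lebesgue"
      by measurable
  qed
  also have "\<dots> = ennreal (T / max 1 T)"
    using T c modular_dilate[OF null h c(1)] by (simp add: ennreal_mult[symmetric])
  also have "\<dots> \<le> 1" by (simp add: divide_simps)
  finally show ?thesis using cK by blast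
qed

text \<open>
  Passing to \<open>\<bar>h\<bar> powr q\<close> and \<open>p / q\<close> only reparametrises the dilation. All choices of \<open>q\<close> can thus
  be compared through the modular of \<open>p\<close> itself.
\<close>

lemma modular_power_dilate:
  fixes h :: "'a::euclidean_space \<Rightarrow> complex"
  assumes null: "infinity_set p \<in> null_sets lebesgue" and h: "h \<in> borel_measurable lebesgue"
    and q: "0 < q" and c: "0 < c"
  shows "modular (\<lambda>x. p x / ennreal q) (\<lambda>x. (norm (h x) powr q) /\<^sub>R c) =
         modular p (\<lambda>x. h x /\<^sub>R (c powr (1/q)))"
proof -
  have inf: "infinity_set (\<lambda>x. p x / ennreal q) = infinity_set p"
    using q by (auto simp: infinity_set_def ennreal_divide_eq_top_iff)
  have e: "enn2real (p x / ennreal q) = enn2real (p x) / q" for x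
    using q by (cases "p x") (auto simp: divide_ennreal ennreal_top_divide)
  have "(norm (h x) powr q / c) powr (enn2real (p x) / q) =
        (norm (h x) / c powr (1/q)) powr enn2real (p x)" for x
    using q c by (simp add: powr_divide powr_powr)
  then show ?thesis using null h q c
    by (subst (1 2) modular_dilate) (auto simp: inf e)
qed

text \<open>
  For exponents that drop below 1, the power \<open>q'\<close> that witnesses membership may differ from the
  power \<open>q\<close> chosen for the quasi-norm; the passage between them goes through the modular of \<open>p\<close>.
\<close>

lemma var_Lp_norm_lower:
  fixes h :: "'a::euclidean_space \<Rightarrow> complex"
  assumes cls: "exponent_ge_1 p \<or> exponent_P0 p"
    and null: "infinity_set p \<in> null_sets lebesgue"
    and P: "0 < P" "AE x in lebesgue. p x \<le> ennreal P"
    and h: "h \<in> var_Lp p"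
    and E: "E \<in> sets lebesgue" "emeasure lebesgue E = ennreal V" "1 < V"
    and d: "0 < d" "\<And>x. x \<in> E \<Longrightarrow> d \<le> norm (h x)"
  shows "d * V powr (1/P) \<le> var_Lp_norm p h"
proof (cases "exponent_ge_1 p")
  case True
  then have hs: "h \<in> lux_space p" using h by (simp add: var_Lp_def)
  then have hm: "h \<in> borel_measurable lebesgue" by (simp add: lux_space_def)
  obtain c where c: "0 < c" "modular p (\<lambda>x. h x /\<^sub>R c) < \<infinity>"
    using hs by (auto simp: lux_space_def)
  have "\<exists>c>0. modular p (\<lambda>x. h x /\<^sub>R c) \<le> 1"
    using True by (intro modular_le_1_nonempty[OF null hm _ _ _ c, of 1]) (auto simp: exponent_ge_1_def)
  then have "d * V powr (1/P) \<le> lux_norm p h" unfolding lux_norm_def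
    by (intro cInf_greatest) (auto intro: lux_lower[OF null hm P E d])
  then show ?thesis using True by (simp add: var_Lp_norm_def)
next
  case False
  then have p: "exponent_P0 p" using cls by simp
  define q where "q = (SOME q. admissible_power p q)"
  obtain q' where q': "admissible_power p q'"
      "(\<lambda>x. norm (h x) powr q') \<in> lux_space (\<lambda>x. p x / ennreal q')"
    and hm: "h \<in> borel_measurable lebesgue"
    using h False by (auto simp: var_Lp_def)
  have "admissible_power p q" unfolding q_def using q'(1) by (rule someI)
  then have q: "0 < q" by (simp add: admissible_power_def)
  have q'0: "0 < q'" using q'(1) by (simp add: admissible_power_def)
  have "AE x in lebesgue. essinf lebesgue p \<le> p x" by (rule AE_essinf_le)
  then have m: "AE x in lebesgue. ennreal q' \<le> p x"
    using q'(1) by (auto simp: admissible_power_def elim!: eventually_mono)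
  obtain c where c: "0 < c" "modular (\<lambda>x. p x / ennreal q') (\<lambda>x. (norm (h x) powr q') /\<^sub>R c) < \<infinity>"
    using q'(2) by (auto simp: lux_space_def)
  have "modular p (\<lambda>x. h x /\<^sub>R (c powr (1/q'))) < \<infinity>"
    using c modular_power_dilate[OF null hm q'0 c(1)] by simp
  then have "\<exists>c>0. modular p (\<lambda>x. h x /\<^sub>R c) \<le> 1"
    using c p by (intro modular_le_1_nonempty[OF null hm _ q'0 m, of "c powr (1/q')"])
      (auto simp: exponent_P0_def)
  then obtain b where b: "0 < b" "modular p (\<lambda>x. h x /\<^sub>R b) \<le> 1" by blast
  let ?S = "{c. c > 0 \<and> modular (\<lambda>x. p x / ennreal q) (\<lambda>x. (norm (h x) powr q) /\<^sub>R c) \<le> 1}"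
  have "b powr q \<in> ?S"
    using b q modular_power_dilate[OF null hm q, of "b powr q"] by (simp add: powr_powr)
  then have "(d * V powr (1/P)) powr q \<le> Inf ?S"
  proof (intro cInf_greatest, blast)
    fix c assume "c \<in> ?S"
    then have c: "0 < c" "modular p (\<lambda>x. h x /\<^sub>R (c powr (1/q))) \<le> 1"
      using modular_power_dilate[OF null hm q, of c] by auto
    have "d * V powr (1/P) \<le> c powr (1/q)"
      using c by (intro lux_lower[OF null hm P E d]) auto
    then have "(d * V powr (1/P)) powr q \<le> (c powr (1/q)) powr q"
      using q d by (intro powr_mono2) auto
    then show "(d * V powr (1/P)) powr q \<le> c" using q c by (simp add: powr_powr)
  qed
  then have "((d * V powr (1/P)) powr q) powr (1/q) \<le> Inf ?S powr (1/q)"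
    using q by (intro powr_mono2) auto
  moreover have "((d * V powr (1/P)) powr q) powr (1/q) = d * V powr (1/P)"
    using q d by (simp add: powr_powr)
  ultimately show ?thesis
    using False by (simp add: var_Lp_norm_def lux_norm_def q_def[symmetric] Let_def)
qed

section \<open>The Fejer kernel and its Fourier transform\<close>

text \<open>
  The Fejer kernel of the line, up to scaling. At 0 division by zero makes its value 0, a change
  on a null set; its continuous extension has the value 1/2 there.
\<close>

definition fejer :: "real \<Rightarrow> real" where
  "fejer x = (1 - cos x) / x\<^sup>2"

definition fejer_mass :: real where
  "fejer_mass = (LINT x|lborel. fejer x)"

text \<open>
  This is \<open>max 0 (1 - \<bar>t\<bar>)\<close>, written as the second difference of the absolute value in which it
  appears as a Fourier transform.
\<close>

definition tent :: "real \<Rightarrow> real" where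
  "tent t = (\<bar>t + 1\<bar> + \<bar>t - 1\<bar>) / 2 - \<bar>t\<bar>"

lemma tent_nonneg: "0 \<le> tent t" and tent_eq_0: "1 \<le> \<bar>t\<bar> \<Longrightarrow> tent t = 0"
  by (auto simp: tent_def)

lemma fejer_nonneg: "0 \<le> fejer x"
  by (simp add: fejer_def)

lemma one_minus_cos_le: "1 - cos (x::real) \<le> x\<^sup>2 / 2"
proof -
  have "\<bar>sin (x/2)\<bar> \<le> \<bar>x/2\<bar>" by (rule abs_sin_x_le_abs_x)
  then have "(sin (x/2))\<^sup>2 \<le> (x/2)\<^sup>2" by (simp only: abs_le_square_iff)
  moreover have "cos x = 1 - 2 * (sin (x/2))\<^sup>2" using cos_double_sin[of "x/2"] by simp
  ultimately show ?thesis by (simp add: power2_eq_square)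
qed

lemma fejer_le_half: "fejer x \<le> 1/2"
  using one_minus_cos_le[of x] by (cases "x = 0") (simp_all add: fejer_def divide_simps)

lemma fejer_measurable [measurable]: "fejer \<in> borel_measurable borel"
  unfolding fejer_def by measurable

lemma fejer_integrable: "integrable lborel fejer"
proof (rule Bochner_Integration.integrable_bound)
  show "integrable lborel (\<lambda>x::real. 5/2 * inverse (1 + x\<^sup>2))"
    using integrable_inverse_1_plus_square by (simp add: set_integrable_def)
  show "AE x in lborel. norm (fejer x) \<le> norm (5/2 * inverse (1 + x\<^sup>2))"
  proof (rule AE_I2)
    fix x :: real
    have "fejer x * x\<^sup>2 \<le> 2" by (cases "x = 0") (auto simp: fejer_def)
    with fejer_le_half[of x] have "fejer x * (1 + x\<^sup>2) \<le> 5/2" by (simp add: distrib_left)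
    moreover have "0 < 1 + x\<^sup>2" by (simp add: add_pos_nonneg)
    ultimately have "fejer x \<le> 5/2 * inverse (1 + x\<^sup>2)" by (simp add: field_simps)
    then show "norm (fejer x) \<le> norm (5/2 * inverse (1 + x\<^sup>2))" using fejer_nonneg[of x] by simp
  qed
qed measurable

lemma fejer_mass_pos: "0 < fejer_mass"
proof -
  have "fejer_mass \<noteq> 0"
  proof
    assume "fejer_mass = 0"
    then have "AE x in lborel. fejer x = 0"
      using integral_nonneg_eq_0_iff_AE[OF fejer_integrable] fejer_nonneg
      by (auto simp: fejer_mass_def)
    then have "AE x in lborel. x \<notin> {1..2::real}"
    proof eventually_elim
      case (elim x)
      show ?case
      proof
        assume x: "x \<in> {1..2}"
        have "cos x < cos 0" using x pi_gt3 by (intro cos_monotone_0_pi) auto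
        with elim x show False by (simp add: fejer_def)
      qed
    qed
    then have "emeasure lborel {1..2::real} = 0" by (subst (asm) AE_iff_measurable[of "{1..2}"]) auto
    then show False by simp
  qed
  moreover have "0 \<le> fejer_mass" unfolding fejer_mass_def by (simp add: fejer_nonneg)
  ultimately show ?thesis by simp
qed

text \<open>
  The substitution \<open>y = t x\<close> reduces every \<open>t \<noteq> 0\<close> to \<open>t = 1\<close>.
\<close>

lemma has_integral_one_minus_cos:
  "has_bochner_integral lborel (\<lambda>x. (1 - cos (t * x)) / x\<^sup>2) (\<bar>t\<bar> * fejer_mass)"
proof (cases "t = 0")
  case True
  then show ?thesis by (simp add: has_bochner_integral_zero)
next
  case False
  have "has_bochner_integral lborel fejer fejer_mass"
    using fejer_integrable by (simp add: has_bochner_integral_iff fejer_mass_def)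
  then have "has_bochner_integral lborel (\<lambda>x. fejer (0 + t * x)) (fejer_mass /\<^sub>R \<bar>t\<bar>)"
    using False by (subst (asm) lborel_has_bochner_integral_real_affine_iff[where c = t and t = 0]) auto
  then have "has_bochner_integral lborel (\<lambda>x. t\<^sup>2 * fejer (0 + t * x)) (t\<^sup>2 * (fejer_mass /\<^sub>R \<bar>t\<bar>))"
    by (intro has_bochner_integral_mult_right) auto
  moreover have "t\<^sup>2 * (fejer_mass /\<^sub>R \<bar>t\<bar>) = \<bar>t\<bar> * fejer_mass"
    using False by (simp add: field_simps power2_eq_square abs_if)
  moreover have "(\<lambda>x. t\<^sup>2 * fejer (0 + t * x)) = (\<lambda>x. (1 - cos (t * x)) / x\<^sup>2)"
    using False by (simp add: fejer_def power_mult_distrib)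
  ultimately show ?thesis by (simp only:)
qed

text \<open>
  The product formula writes \<open>(1 - cos x) cos (t x)\<close> as a combination of \<open>1 - cos (s x)\<close> for
  \<open>s\<close> in \<open>{t - 1, t, t + 1}\<close>, and the coefficients \<open>1/2, -1, 1/2\<close> form a second difference.
\<close>

lemma integral_fejer_cos:
  "has_bochner_integral lborel (\<lambda>x. fejer x * cos (t * x)) (fejer_mass * tent t)"
proof -
  have "has_bochner_integral lborel
      (\<lambda>x. 1/2 * ((1 - cos ((t + 1) * x)) / x\<^sup>2) + 1/2 * ((1 - cos ((t - 1) * x)) / x\<^sup>2)
            - (1 - cos (t * x)) / x\<^sup>2)
      (1/2 * (\<bar>t + 1\<bar> * fejer_mass) + 1/2 * (\<bar>t - 1\<bar> * fejer_mass) - \<bar>t\<bar> * fejer_mass)"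
    by (intro has_bochner_integral_add has_bochner_integral_diff has_bochner_integral_mult_right
          has_integral_one_minus_cos)
  moreover have "1/2 * ((1 - cos ((t + 1) * x)) / x\<^sup>2) + 1/2 * ((1 - cos ((t - 1) * x)) / x\<^sup>2)
            - (1 - cos (t * x)) / x\<^sup>2 = fejer x * cos (t * x)" for x
  proof -
    have "1/2 * (1 - cos ((t + 1) * x)) + 1/2 * (1 - cos ((t - 1) * x)) - (1 - cos (t * x))
        = (1 - cos x) * cos (t * x)"
      by (simp add: cos_add cos_diff algebra_simps)
    moreover have "1/2 * (a / y) + 1/2 * (b / y) - c / y = (1/2 * a + 1/2 * b - c) / y" for a b c y :: real
      by (simp add: add_divide_distrib diff_divide_distrib)
    ultimately show ?thesis by (simp only: fejer_def times_divide_eq_left)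
  qed
  moreover have "1/2 * (\<bar>t + 1\<bar> * fejer_mass) + 1/2 * (\<bar>t - 1\<bar> * fejer_mass) - \<bar>t\<bar> * fejer_mass
     = fejer_mass * tent t" by (simp add: tent_def algebra_simps)
  ultimately show ?thesis by simp
qed

lemma integrable_fejer_cis:
  "integrable lborel (\<lambda>x. complex_of_real (fejer x) * cis (t * x))"
proof (rule Bochner_Integration.integrable_bound[OF fejer_integrable])
  show "(\<lambda>x. complex_of_real (fejer x) * cis (t * x)) \<in> borel_measurable lborel"
    by (intro borel_measurable_times) (auto simp: cis_conv_exp)
qed (simp add: norm_mult)

lemma integral_fejer_cis:
  "(LINT x|lborel. complex_of_real (fejer x) * cis (t * x)) = of_real (fejer_mass * tent t)"
proof (rule complex_eqI)
  let ?F = "\<lambda>x. complex_of_real (fejer x) * cis (t * x)"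
  have "Re (integral\<^sup>L lborel ?F) = (LINT x|lborel. Re (?F x))"
    by (rule integral_Re[OF integrable_fejer_cis, symmetric])
  also have "\<dots> = fejer_mass * tent t"
    using integral_fejer_cos[of t] by (simp add: has_bochner_integral_iff)
  finally show "Re (integral\<^sup>L lborel ?F) = Re (of_real (fejer_mass * tent t))" by simp
  \<comment> \<open>The imaginary part integrates an odd function.\<close>
  have "Im (integral\<^sup>L lborel ?F) = (LINT x|lborel. fejer x * sin (t * x))"
    using integrable_fejer_cis[of t] by (simp add: integral_Im[symmetric])
  also have "\<dots> = \<bar>-1\<bar> *\<^sub>R (LINT x|lborel. fejer (0 + (-1) * x) * sin (t * (0 + (-1) * x)))"
    by (rule lborel_integral_real_affine) simp
  also have "\<dots> = - (LINT x|lborel. fejer x * sin (t * x))" by (simp add: fejer_def)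
  finally have "Im (integral\<^sup>L lborel ?F) = 0"
    using integrable_fejer_cis[of t] by (simp add: integral_Im[symmetric])
  then show "Im (integral\<^sup>L lborel ?F) = Im (of_real (fejer_mass * tent t))" by simp
qed

lemma integral_lborel_prod_Basis:
  fixes f :: "'a::euclidean_space \<Rightarrow> real \<Rightarrow> 'b::{real_normed_field,banach,second_countable_topology}"
  assumes "\<And>b. b \<in> Basis \<Longrightarrow> integrable lborel (f b)"
  shows "has_bochner_integral lborel (\<lambda>x::'a. \<Prod>b\<in>Basis. f b (x \<bullet> b)) (\<Prod>b\<in>Basis. integral\<^sup>L lborel (f b))"
proof -
  interpret product_sigma_finite "\<lambda>_::'a. lborel :: real measure" ..
  let ?P = "Pi\<^sub>M (Basis::'a set) (\<lambda>_. lborel :: real measure)"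
  let ?T = "\<lambda>y. \<Sum>b\<in>Basis. y b *\<^sub>R (b::'a)"
  have fm: "f b \<in> borel_measurable borel" if "b \<in> Basis" for b
    using assms[OF that] by simp
  have m: "(\<lambda>x::'a. \<Prod>b\<in>Basis. f b (x \<bullet> b)) \<in> borel_measurable borel"
    by (intro borel_measurable_prod measurable_compose[OF _ fm]) auto
  have T: "?T \<in> ?P \<rightarrow>\<^sub>M borel" by measurable
  have eq: "(\<Prod>b\<in>Basis. f b (?T y \<bullet> b)) = (\<Prod>b\<in>Basis. f b (y b))" for y
    by (intro prod.cong) auto
  have "has_bochner_integral ?P (\<lambda>y. \<Prod>b\<in>Basis. f b (y b)) (\<Prod>b\<in>Basis. integral\<^sup>L lborel (f b))"
    using assms by (auto simp: has_bochner_integral_iff product_integrable_prod product_integral_prod)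
  then show ?thesis
    using m T by (subst lborel_eq) (simp add: has_bochner_integral_iff integrable_distr_eq integral_distr eq)
qed

lemma integral_lborel_affine:
  fixes f :: "'a::euclidean_space \<Rightarrow> 'b::{banach,second_countable_topology}"
  assumes [measurable]: "f \<in> borel_measurable borel" and "c \<noteq> 0"
  shows "(LINT x|lborel. f x) = \<bar>c\<bar>^DIM('a) *\<^sub>R (LINT x|lborel. f (t + c *\<^sub>R x))"
  by (subst lborel_affine[OF assms(2), of t])
    (simp add: integral_density integral_distr)

lemma integrable_lborel_affine:
  fixes f :: "'a::euclidean_space \<Rightarrow> 'b::{banach,second_countable_topology}"
  assumes "integrable lborel f" and "c \<noteq> 0"
  shows "integrable lborel (\<lambda>x. f (t + c *\<^sub>R x))"
proof -
  have [measurable]: "f \<in> borel_measurable borel" using assms(1) by simp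
  have "integrable (density (distr lborel borel (\<lambda>x. t + c *\<^sub>R x)) (\<lambda>_. \<bar>c\<bar> ^ DIM('a))) f"
    using assms(1) lborel_affine[OF assms(2), of t] by simp
  with assms(2) have "integrable lborel (\<lambda>x. \<bar>c\<bar> ^ DIM('a) *\<^sub>R f (t + c *\<^sub>R x))"
    by (simp add: integrable_density integrable_distr_eq)
  then have "integrable lborel (\<lambda>x. inverse (\<bar>c\<bar> ^ DIM('a)) *\<^sub>R (\<bar>c\<bar> ^ DIM('a) *\<^sub>R f (t + c *\<^sub>R x)))"
    by (rule integrable_scaleR_right)
  then show ?thesis using assms(2) by simp
qed

lemma cis_sum: "finite A \<Longrightarrow> cis (\<Sum>a\<in>A. f a) = (\<Prod>a\<in>A. cis (f a))"
  by (induction rule: finite_induct) (auto simp: cis_mult[symmetric])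

definition fejer_prod :: "'a::euclidean_space \<Rightarrow> real" where
  "fejer_prod x = (\<Prod>b\<in>Basis. fejer (x \<bullet> b))"

text \<open>
  The Fourier transform of \<open>fejer_prod\<close>; the factor \<open>2 \<pi>\<close> comes from the normalisation of
  \<open>fourier_L1\<close>.
\<close>

definition tent_prod :: "'a::euclidean_space \<Rightarrow> real" where
  "tent_prod \<xi> = (\<Prod>b\<in>Basis. fejer_mass * tent (2 * pi * (\<xi> \<bullet> b)))"

lemma fejer_prod_nonneg: "0 \<le> fejer_prod x"
  unfolding fejer_prod_def by (intro prod_nonneg) (simp add: fejer_nonneg)

lemma fejer_prod_le_1: "fejer_prod x \<le> 1"
  unfolding fejer_prod_def
  by (intro prod_le_1) (auto simp: fejer_nonneg intro: order_trans[OF fejer_le_half])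

lemma fejer_prod_measurable [measurable]: "fejer_prod \<in> borel_measurable borel"
  unfolding fejer_prod_def by measurable

lemma fejer_prod_integrable: "integrable lborel (fejer_prod :: 'a::euclidean_space \<Rightarrow> real)"
  unfolding fejer_prod_def
  using integral_lborel_prod_Basis[of "\<lambda>_::'a. fejer"] fejer_integrable
  by (auto simp: has_bochner_integral_iff)

lemma fourier_fejer_prod:
  fixes \<xi> :: "'a::euclidean_space"
  shows "(LINT x|lborel. complex_of_real (fejer_prod x) * cis (- (2 * pi * (x \<bullet> \<xi>))))
      = of_real (tent_prod \<xi>)"
proof -
  have tsym: "tent (- t) = tent t" for t by (auto simp: tent_def abs_real_def)
  have "complex_of_real (fejer_prod x) * cis (- (2 * pi * (x \<bullet> \<xi>)))
     = (\<Prod>b\<in>Basis. complex_of_real (fejer (x \<bullet> b)) * cis (- (2 * pi * (\<xi> \<bullet> b)) * (x \<bullet> b)))" for x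
  proof -
    have "- (2 * pi * (x \<bullet> \<xi>)) = (\<Sum>b\<in>Basis. - (2 * pi * (\<xi> \<bullet> b)) * (x \<bullet> b))"
      by (subst euclidean_inner) (simp add: sum_distrib_left sum_negf mult_ac)
    then show ?thesis by (simp add: cis_sum prod.distrib fejer_prod_def)
  qed
  then have "(LINT x|lborel. complex_of_real (fejer_prod x) * cis (- (2 * pi * (x \<bullet> \<xi>))))
    = (LINT x|lborel. (\<Prod>b\<in>Basis. complex_of_real (fejer (x \<bullet> b)) * cis (- (2 * pi * (\<xi> \<bullet> b)) * (x \<bullet> b))))"
    by (simp only:)
  also have "\<dots> = (\<Prod>b\<in>Basis. LINT x|lborel. complex_of_real (fejer x) * cis (- (2 * pi * (\<xi> \<bullet> b)) * x))"
    by (intro has_bochner_integral_integral_eq integral_lborel_prod_Basis integrable_fejer_cis)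
  also have "\<dots> = of_real (tent_prod \<xi>)"
    by (simp only: integral_fejer_cis tsym tent_prod_def of_real_prod)
  finally show ?thesis .
qed

lemma tent_prod_nonneg: "0 \<le> tent_prod \<xi>"
  unfolding tent_prod_def using fejer_mass_pos tent_nonneg by (intro prod_nonneg) (auto intro: mult_nonneg_nonneg)

lemma tent_prod_0_pos: "0 < tent_prod 0"
  unfolding tent_prod_def using fejer_mass_pos by (intro prod_pos) (auto simp: tent_def)

lemma continuous_tent_prod: "continuous_on S tent_prod"
  unfolding tent_prod_def tent_def by (intro continuous_intros) auto

lemma tent_prod_measurable [measurable]: "tent_prod \<in> borel_measurable borel"
  by (intro borel_measurable_continuous_onI continuous_tent_prod)

text \<open>
  Each coordinate of a point of the support is at most 1 in absolute value (indeed at most \<open>1 / (2 \<pi>)\<close>).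
\<close>

lemma tent_prod_support:
  fixes \<xi> :: "'a::euclidean_space"
  assumes "tent_prod \<xi> \<noteq> 0" shows "norm \<xi> \<le> DIM('a)"
proof -
  have "\<bar>\<xi> \<bullet> b\<bar> \<le> 1" if "b \<in> Basis" for b
  proof (rule ccontr)
    assume "\<not> ?thesis"
    then have "1 * 1 \<le> (2 * pi) * \<bar>\<xi> \<bullet> b\<bar>" using pi_gt3 by (intro mult_mono) auto
    then have "tent (2 * pi * (\<xi> \<bullet> b)) = 0" by (intro tent_eq_0) (simp add: abs_mult)
    then show False using assms that by (auto simp: tent_prod_def)
  qed
  then have "(\<Sum>b\<in>Basis. \<bar>\<xi> \<bullet> b\<bar>) \<le> real DIM('a) * 1" by (intro sum_bounded_above) auto
  then show ?thesis using norm_le_l1[of \<xi>] by simp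
qed

section \<open>Wave packets\<close>

definition packet :: "'a::euclidean_space \<Rightarrow> real \<Rightarrow> 'a \<Rightarrow> complex" where
  "packet \<xi>\<^sub>0 R x = cis (2 * pi * (x \<bullet> \<xi>\<^sub>0)) * of_real (fejer_prod (x /\<^sub>R R))"

definition packet_hat :: "'a::euclidean_space \<Rightarrow> real \<Rightarrow> 'a \<Rightarrow> complex" where
  "packet_hat \<xi>\<^sub>0 R \<xi> = of_real (R ^ DIM('a) * tent_prod (R *\<^sub>R (\<xi> - \<xi>\<^sub>0)))"

lemma cis_measurable [measurable]: "cis \<in> borel_measurable borel"
  by (intro borel_measurable_continuous_onI continuous_intros)

lemma packet_measurable [measurable]: "packet \<xi>\<^sub>0 R \<in> borel_measurable borel"
  unfolding packet_def by measurable

lemma norm_packet: "norm (packet \<xi>\<^sub>0 R x) = fejer_prod (x /\<^sub>R R)"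
  by (simp add: packet_def norm_mult fejer_prod_nonneg)

text \<open>
  The norm of a packet has integral of order \<open>R ^ n\<close>, which is what \<open>lux_upper\<close> asks for.
\<close>

lemma packet_integral:
  fixes \<xi>\<^sub>0 :: "'a::euclidean_space"
  assumes "0 < R"
  shows "has_bochner_integral lborel (\<lambda>x. norm (packet \<xi>\<^sub>0 R x))
           (R ^ DIM('a) * (LINT x|lborel. fejer_prod (x::'a)))"
proof -
  have "integrable lborel (\<lambda>x::'a. fejer_prod (0 + inverse R *\<^sub>R x))"
    using assms by (intro integrable_lborel_affine fejer_prod_integrable) auto
  moreover have "(LINT x|lborel. fejer_prod (0 + inverse R *\<^sub>R (x::'a)))
      = R ^ DIM('a) *\<^sub>R (LINT x|lborel. fejer_prod (0 + inverse R *\<^sub>R (0 + R *\<^sub>R (x::'a))))"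
    using assms by (subst integral_lborel_affine[of _ R 0]) auto
  ultimately show ?thesis using assms by (simp add: norm_packet has_bochner_integral_iff)
qed

lemma fourier_packet:
  fixes \<xi>\<^sub>0 :: "'a::euclidean_space"
  assumes "0 < R"
  shows "fourier_L1 (packet \<xi>\<^sub>0 R) = packet_hat \<xi>\<^sub>0 R"
proof
  fix \<xi> :: 'a
  have e: "exp (- 2 * of_real pi * \<i> * of_real t) = cis (- (2 * pi * t))" for t
    by (simp add: cis_conv_exp mult_ac)
  have "fourier_L1 (packet \<xi>\<^sub>0 R) \<xi> = (LINT x|lborel. packet \<xi>\<^sub>0 R x * cis (- (2 * pi * (x \<bullet> \<xi>))))"
    unfolding fourier_L1_def e by (intro integral_completion) measurable
  also have "\<dots> = (LINT x|lborel. complex_of_real (fejer_prod (x /\<^sub>R R)) * cis (- (2 * pi * (x \<bullet> (\<xi> - \<xi>\<^sub>0)))))"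
  proof (rule Bochner_Integration.integral_cong[OF refl])
    fix x :: 'a
    have "packet \<xi>\<^sub>0 R x * cis (- (2 * pi * (x \<bullet> \<xi>)))
       = complex_of_real (fejer_prod (x /\<^sub>R R)) * (cis (2 * pi * (x \<bullet> \<xi>\<^sub>0)) * cis (- (2 * pi * (x \<bullet> \<xi>))))"
      unfolding packet_def by (simp only: mult_ac)
    also have "2 * pi * (x \<bullet> \<xi>\<^sub>0) + - (2 * pi * (x \<bullet> \<xi>)) = - (2 * pi * (x \<bullet> (\<xi> - \<xi>\<^sub>0)))"
      by (simp add: inner_diff_right right_diff_distrib)
    then have "cis (2 * pi * (x \<bullet> \<xi>\<^sub>0)) * cis (- (2 * pi * (x \<bullet> \<xi>))) = cis (- (2 * pi * (x \<bullet> (\<xi> - \<xi>\<^sub>0))))"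
      by (simp only: cis_mult)
    finally show "packet \<xi>\<^sub>0 R x * cis (- (2 * pi * (x \<bullet> \<xi>)))
       = complex_of_real (fejer_prod (x /\<^sub>R R)) * cis (- (2 * pi * (x \<bullet> (\<xi> - \<xi>\<^sub>0))))" .
  qed
  also have "\<dots> = R ^ DIM('a) *\<^sub>R (LINT x|lborel. complex_of_real (fejer_prod x) * cis (- (2 * pi * (x \<bullet> (R *\<^sub>R (\<xi> - \<xi>\<^sub>0))))))"
    using assms by (subst integral_lborel_affine[of _ R 0]) (auto simp: mult_ac)
  also have "\<dots> = packet_hat \<xi>\<^sub>0 R \<xi>"
    unfolding fourier_fejer_prod by (simp add: packet_hat_def scaleR_conv_of_real)
  finally show "fourier_L1 (packet \<xi>\<^sub>0 R) \<xi> = packet_hat \<xi>\<^sub>0 R \<xi>" .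
qed

lemma continuous_packet_hat: "continuous_on S (packet_hat \<xi>\<^sub>0 R)"
  unfolding packet_hat_def by (intro continuous_intros continuous_on_compose2[OF continuous_tent_prod]) auto

lemma packet_hat_measurable [measurable]: "packet_hat \<xi>\<^sub>0 R \<in> borel_measurable borel"
  by (intro borel_measurable_continuous_onI continuous_packet_hat)

lemma packet_hat_support:
  fixes \<xi> \<xi>\<^sub>0 :: "'a::euclidean_space"
  assumes "0 < R" "\<xi> \<notin> cball \<xi>\<^sub>0 (DIM('a) / R)"
  shows "packet_hat \<xi>\<^sub>0 R \<xi> = 0"
proof (rule ccontr)
  assume "packet_hat \<xi>\<^sub>0 R \<xi> \<noteq> 0"
  then have "norm (R *\<^sub>R (\<xi> - \<xi>\<^sub>0)) \<le> DIM('a)" by (intro tent_prod_support) (auto simp: packet_hat_def)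
  then have "R * norm (\<xi> - \<xi>\<^sub>0) \<le> DIM('a)" using assms(1) by (simp only: norm_scaleR abs_of_pos)
  then show False using assms by (simp add: dist_norm norm_minus_commute field_simps)
qed

lemma integrable_continuous_compact_support:
  fixes f :: "'a::euclidean_space \<Rightarrow> 'b::{banach,second_countable_topology}"
  assumes "continuous_on UNIV f" "compact K" "\<And>x. x \<notin> K \<Longrightarrow> f x = 0"
  shows "integrable lborel f"
proof -
  have "integrable lborel (\<lambda>x. indicator K x *\<^sub>R f x)"
    using assms by (intro borel_integrable_compact) (auto intro: continuous_on_subset)
  moreover have "(\<lambda>x. indicator K x *\<^sub>R f x) = f" using assms(3) by (auto simp: indicator_def)
  ultimately show ?thesis by simp
qed

lemma bounded_compact_support_packet_hat:
  fixes \<xi>\<^sub>0 :: "'a::euclidean_space"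
  assumes "0 < R" shows "bounded_compact_support (packet_hat \<xi>\<^sub>0 R)"
proof -
  let ?K = "cball \<xi>\<^sub>0 (DIM('a) / R)"
  have "packet_hat \<xi>\<^sub>0 R \<xi> \<in> insert 0 (packet_hat \<xi>\<^sub>0 R ` ?K)" for \<xi>
    using packet_hat_support[OF assms, of \<xi> \<xi>\<^sub>0] by (cases "\<xi> \<in> ?K") (simp_all del: mem_cball)
  then have "range (packet_hat \<xi>\<^sub>0 R) \<subseteq> insert 0 (packet_hat \<xi>\<^sub>0 R ` ?K)" by blast
  moreover have "bounded (insert 0 (packet_hat \<xi>\<^sub>0 R ` ?K))"
    by (intro compact_imp_bounded compact_insert compact_continuous_image continuous_packet_hat) auto
  ultimately have "bounded (range (packet_hat \<xi>\<^sub>0 R))" by (rule bounded_subset[rotated])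
  moreover have "compact ?K \<and> (\<forall>\<xi>. \<xi> \<notin> ?K \<longrightarrow> packet_hat \<xi>\<^sub>0 R \<xi> = 0)"
    by (auto simp: packet_hat_support[OF assms])
  ultimately show ?thesis unfolding bounded_compact_support_def by blast
qed

text \<open>
  The packet is integrable and its transform square integrable, so the constant sequence is an
  admissible approximation.
\<close>

lemma fourier_L2_packet:
  fixes \<xi>\<^sub>0 :: "'a::euclidean_space"
  assumes "0 < R" shows "fourier_L2 (packet \<xi>\<^sub>0 R) (packet_hat \<xi>\<^sub>0 R)"
proof -
  have int: "integrable lborel (packet \<xi>\<^sub>0 R)"
    using packet_integral[OF assms, of \<xi>\<^sub>0] by (simp add: has_bochner_integral_iff integrable_norm_iff)
  have "integrable lborel (\<lambda>x. (norm (packet \<xi>\<^sub>0 R x))\<^sup>2)"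
  proof (rule Bochner_Integration.integrable_bound[OF int])
    show "AE x in lborel. norm ((norm (packet \<xi>\<^sub>0 R x))\<^sup>2) \<le> norm (packet \<xi>\<^sub>0 R x)"
      by (intro AE_I2) (auto simp: norm_packet fejer_prod_nonneg power2_eq_square
          intro!: mult_left_le fejer_prod_le_1)
  qed measurable
  then have 1: "packet \<xi>\<^sub>0 R \<in> L2_functions"
    unfolding L2_functions_def by (auto simp: integrable_completion intro: measurable_completion)
  have "integrable lborel (\<lambda>x. (norm (packet_hat \<xi>\<^sub>0 R x))\<^sup>2)"
  proof (rule integrable_continuous_compact_support)
    show "continuous_on UNIV (\<lambda>x. (norm (packet_hat \<xi>\<^sub>0 R x))\<^sup>2)"
      by (intro continuous_on_power continuous_on_norm continuous_packet_hat)
    show "compact (cball \<xi>\<^sub>0 (DIM('a) / R))" by simp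
  qed (simp add: packet_hat_support[OF assms])
  then have 2: "packet_hat \<xi>\<^sub>0 R \<in> L2_functions"
    unfolding L2_functions_def by (auto simp: integrable_completion intro: measurable_completion)
  have 3: "integrable lebesgue (packet \<xi>\<^sub>0 R)"
    using int by (simp add: integrable_completion)
  have "(\<lambda>k::nat. L2_dist_sq (packet \<xi>\<^sub>0 R) (packet \<xi>\<^sub>0 R)) \<longlonglongrightarrow> 0"
    "(\<lambda>k::nat. L2_dist_sq (packet_hat \<xi>\<^sub>0 R) (packet_hat \<xi>\<^sub>0 R)) \<longlonglongrightarrow> 0"
    by (simp_all add: L2_dist_sq_def)
  then have "\<exists>h :: nat \<Rightarrow> 'a \<Rightarrow> complex.
        (\<forall>k. integrable lebesgue (h k) \<and> h k \<in> L2_functions \<and> fourier_L1 (h k) \<in> L2_functions) \<and>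
        (\<lambda>k. L2_dist_sq (h k) (packet \<xi>\<^sub>0 R)) \<longlonglongrightarrow> 0 \<and>
        (\<lambda>k. L2_dist_sq (fourier_L1 (h k)) (packet_hat \<xi>\<^sub>0 R)) \<longlonglongrightarrow> 0"
    using 1 2 3 by (intro exI[of _ "\<lambda>_. packet \<xi>\<^sub>0 R"]) (simp add: fourier_packet[OF assms])
  with 1 2 show ?thesis unfolding fourier_L2_def by blast
qed

section \<open>The multiplier on wave packets\<close>

lemma norm_cis_minus_1_le: "norm (cis t - 1) \<le> \<bar>t\<bar>"
proof -
  have "norm (cis t - 1) = 2 * \<bar>sin (t / 2)\<bar>" using dist_exp_i_1[of t] by (simp add: cis_conv_exp)
  also have "\<dots> \<le> 2 * \<bar>t / 2\<bar>" by (intro mult_left_mono abs_sin_x_le_abs_x) auto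
  finally show ?thesis by simp
qed

text \<open>
  Averaging against a nonnegative weight cannot cancel a function that stays within half of \<open>\<bar>m\<bar>\<close>
  of the constant \<open>m\<close>.
\<close>

lemma norm_integral_near_constant:
  fixes W :: "'b \<Rightarrow> real" and k :: "'b \<Rightarrow> complex"
  assumes W: "integrable N W" "\<And>z. 0 \<le> W z"
    and k: "k \<in> borel_measurable N"
    and near: "\<And>z. W z \<noteq> 0 \<Longrightarrow> norm (k z - m) \<le> norm m / 2"
  shows "norm m / 2 * (LINT z|N. W z) \<le> norm (LINT z|N. of_real (W z) * k z)"
proof -
  have Wm: "W \<in> borel_measurable N" using W by auto
  have le: "norm (of_real (W z) * (k z - m)) \<le> norm m / 2 * W z" for z
    using near[of z] W(2)[of z] by (cases "W z = 0") (auto simp: norm_mult mult.commute intro: mult_left_mono)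
  have i0: "integrable N (\<lambda>z. norm m / 2 * W z)" using W(1) by simp
  have i1: "integrable N (\<lambda>z. complex_of_real (W z) * (k z - m))"
  proof (rule Bochner_Integration.integrable_bound[OF i0])
    show "(\<lambda>z. complex_of_real (W z) * (k z - m)) \<in> borel_measurable N"
      using Wm k by measurable
    show "AE z in N. norm (complex_of_real (W z) * (k z - m)) \<le> norm (norm m / 2 * W z)"
      using le W(2) by (intro AE_I2) (simp add: abs_mult)
  qed
  have i2: "integrable N (\<lambda>z. complex_of_real (W z) * m)" using W(1) by auto
  have "(LINT z|N. of_real (W z) * k z) = (LINT z|N. of_real (W z) * (k z - m) + of_real (W z) * m)"
    by (simp add: algebra_simps)
  also have "\<dots> = (LINT z|N. of_real (W z) * (k z - m)) + (LINT z|N. of_real (W z) * m)"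
    by (rule Bochner_Integration.integral_add[OF i1 i2])
  finally have eq: "(LINT z|N. of_real (W z) * k z)
      = (LINT z|N. of_real (W z) * (k z - m)) + of_real (LINT z|N. W z) * m" by simp
  have "norm (LINT z|N. of_real (W z) * (k z - m)) \<le> (LINT z|N. norm m / 2 * W z)"
    using i0 i1 le by (intro order_trans[OF integral_norm_bound] integral_mono) auto
  moreover have "norm (of_real (LINT z|N. W z) * m) = norm m * (LINT z|N. W z)"
    using W(2) by (simp add: norm_mult mult.commute)
  ultimately show ?thesis unfolding eq
    using norm_diff_ineq[of "of_real (LINT z|N. W z) * m" "LINT z|N. of_real (W z) * (k z - m)"]
    by (simp add: add.commute)
qed

text \<open>
  Substituting \<open>\<xi> = \<xi>\<^sub>0 + u / R\<close>, \<open>\<eta> = v / R\<close> on the product space turns the transforms into a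
  weight that does not depend on \<open>R\<close>: the Jacobian \<open>R^(-2n)\<close> cancels the two amplitudes \<open>R^n\<close>,
  and the factor \<open>exp (2 \<pi> \<i> (\<xi>\<^sub>0 \<bullet> x))\<close> has modulus 1.
\<close>

lemma bilinear_mult_packets:
  fixes \<xi>\<^sub>0 :: "'a::euclidean_space"
  assumes M: "continuous_on UNIV M" and R: "0 < R"
  shows "norm (bilinear_mult M (packet_hat \<xi>\<^sub>0 R) (packet_hat 0 R) x)
     = norm (LINT z|lborel. of_real (tent_prod (fst z) * tent_prod (snd z)) *
          (M (\<xi>\<^sub>0 + (fst z - snd z) /\<^sub>R R) * cis (2 * pi * (((fst z + snd z) /\<^sub>R R) \<bullet> x))))"
proof -
  have [measurable]: "M \<in> borel_measurable borel" using M by (rule borel_measurable_continuous_onI)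
  let ?n = "DIM('a)"
  have e: "exp (2 * of_real pi * \<i> * of_real t) = cis (2 * pi * t)" for t
    by (simp add: cis_conv_exp mult_ac)
  define \<Phi> where "\<Phi> z = packet_hat \<xi>\<^sub>0 R (fst z) * packet_hat 0 R (snd z) * M (fst z - snd z)
     * cis (2 * pi * ((fst z + snd z) \<bullet> x))" for z :: "'a \<times> 'a"
  have m: "\<Phi> \<in> borel_measurable borel" unfolding \<Phi>_def
    by (intro borel_measurable_continuous_onI continuous_intros continuous_on_compose2[OF M]
        continuous_on_compose2[OF continuous_packet_hat[of UNIV]]) auto
  have aff: "\<Phi> ((\<xi>\<^sub>0, 0) + inverse R *\<^sub>R z) = of_real (R ^ (2 * ?n)) * cis (2 * pi * (\<xi>\<^sub>0 \<bullet> x)) *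
     (of_real (tent_prod (fst z) * tent_prod (snd z)) *
       (M (\<xi>\<^sub>0 + (fst z - snd z) /\<^sub>R R) * cis (2 * pi * (((fst z + snd z) /\<^sub>R R) \<bullet> x))))" for z
  proof -
    have 1: "\<xi>\<^sub>0 + fst z /\<^sub>R R - snd z /\<^sub>R R = \<xi>\<^sub>0 + (fst z - snd z) /\<^sub>R R" by (simp add: scaleR_diff_right)
    have 2: "2 * pi * ((\<xi>\<^sub>0 + fst z /\<^sub>R R + snd z /\<^sub>R R) \<bullet> x)
        = 2 * pi * (\<xi>\<^sub>0 \<bullet> x) + 2 * pi * (((fst z + snd z) /\<^sub>R R) \<bullet> x)"
      by (simp add: inner_add_left scaleR_add_right distrib_left add_divide_distrib)
    have 3: "packet_hat \<xi>\<^sub>0 R (\<xi>\<^sub>0 + fst z /\<^sub>R R) = of_real (R ^ ?n) * of_real (tent_prod (fst z))"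
      using R by (simp add: packet_hat_def)
    have 4: "packet_hat 0 R (snd z /\<^sub>R R) = of_real (R ^ ?n) * of_real (tent_prod (snd z))"
      using R by (simp add: packet_hat_def)
    have 5: "fst ((\<xi>\<^sub>0, 0) + inverse R *\<^sub>R z) = \<xi>\<^sub>0 + fst z /\<^sub>R R"
      "snd ((\<xi>\<^sub>0, 0) + inverse R *\<^sub>R z) = snd z /\<^sub>R R" by auto
    have 6: "complex_of_real (R ^ (2 * ?n)) = of_real (R ^ ?n) * of_real (R ^ ?n)"
      by (simp add: mult_2 power_add)
    show ?thesis unfolding \<Phi>_def 5 1 2 3 4 6 cis_mult[symmetric] of_real_mult
      by (simp only: mult_ac)
  qed
  have "bilinear_mult M (packet_hat \<xi>\<^sub>0 R) (packet_hat 0 R) x = (LINT z|lebesgue. \<Phi> z)"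
    unfolding bilinear_mult_def e \<Phi>_def by (simp add: case_prod_beta')
  also have "\<dots> = (LINT z|lborel. \<Phi> z)" using m by (intro integral_completion) simp
  also have "\<dots> = \<bar>inverse R\<bar> ^ DIM('a \<times> 'a) *\<^sub>R (LINT z|lborel. \<Phi> ((\<xi>\<^sub>0, 0) + inverse R *\<^sub>R z))"
    using R m by (intro integral_lborel_affine) auto
  finally have "norm (bilinear_mult M (packet_hat \<xi>\<^sub>0 R) (packet_hat 0 R) x)
     = inverse R ^ (2 * ?n) * norm (LINT z|lborel. \<Phi> ((\<xi>\<^sub>0, 0) + inverse R *\<^sub>R z))"
    using R by (simp add: mult_2)
  then show ?thesis unfolding aff integral_mult_right_zero norm_mult
    using R by (simp add: power_inverse norm_power)
qed

text \<open>
  In the rescaled integral the argument of \<open>M\<close> is within \<open>2 n / R\<close> of \<open>\<xi>\<^sub>0\<close> and the phase is at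
  most \<open>4 \<pi> n \<epsilon>\<close>, so both are almost constant on the support of the weight and the integral is
  comparable to \<open>M \<xi>\<^sub>0\<close> times the total weight.
\<close>

lemma bilinear_mult_lower:
  fixes \<xi>\<^sub>0 :: "'a::euclidean_space"
  assumes M: "continuous_on UNIV M" and nz: "M \<xi>\<^sub>0 \<noteq> 0"
  obtains \<delta> \<epsilon> R\<^sub>0 where "0 < \<delta>" "0 < \<epsilon>" "1 \<le> R\<^sub>0"
    "\<And>R x. R\<^sub>0 \<le> R \<Longrightarrow> norm x \<le> \<epsilon> * R \<Longrightarrow>
       \<delta> \<le> norm (bilinear_mult M (packet_hat \<xi>\<^sub>0 R) (packet_hat 0 R) x)"
proof -
  have [measurable]: "M \<in> borel_measurable borel" using M by (rule borel_measurable_continuous_onI)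
  let ?m = "M \<xi>\<^sub>0" and ?r = "real DIM('a)"
  have r: "0 < ?r" by simp
  define W where "W z = tent_prod (fst z) * tent_prod (snd z)" for z :: "'a \<times> 'a"
  have W0: "0 \<le> W z" for z by (simp add: W_def tent_prod_nonneg)
  have Wc: "continuous_on S W" for S
    unfolding W_def by (intro continuous_intros continuous_on_compose2[OF continuous_tent_prod[of UNIV]]) auto
  have Ws: "norm (fst z) \<le> ?r \<and> norm (snd z) \<le> ?r" if "W z \<noteq> 0" for z
    using that by (auto simp: W_def intro!: tent_prod_support)
  have Wi: "integrable lborel W"
  proof (rule integrable_continuous_compact_support[OF Wc])
    show "compact (cball (0::'a) ?r \<times> cball (0::'a) ?r)" by (intro compact_Times compact_cball)
    show "W z = 0" if "z \<notin> cball (0::'a) ?r \<times> cball (0::'a) ?r" for z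
      using that Ws[of z] by (cases z) auto
  qed
  define A where "A = (LINT z|lborel. W z)"
  \<comment> \<open>The weight is continuous and positive at the origin.\<close>
  have "A \<noteq> 0"
  proof
    assume "A = 0"
    then have ae: "AE z in lborel. W z = 0"
      using integral_nonneg_eq_0_iff_AE[OF Wi] W0 by (simp add: A_def)
    have "open {z. W z \<noteq> 0}" using Wc by (intro open_Collect_neq continuous_on_const)
    moreover have "W 0 \<noteq> 0" using tent_prod_0_pos[where 'a = 'a] by (simp add: W_def less_le)
    ultimately obtain e where e: "0 < e" "ball 0 e \<subseteq> {z. W z \<noteq> 0}"
      by (auto elim: openE)
    have "AE z in lborel. z \<notin> ball (0::'a \<times> 'a) e" using ae by eventually_elim (use e in auto)
    then have "emeasure lborel (ball (0::'a \<times> 'a) e) = 0"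
      by (subst (asm) AE_iff_measurable[of "ball (0::'a \<times> 'a) e"]) auto
    moreover have "unit_ball_vol (real DIM('a \<times> 'a)) \<noteq> 0" using unit_ball_vol_pos[of "real DIM('a \<times> 'a)"] by linarith
    ultimately show False using e(1) by (simp add: emeasure_ball)
  qed
  then have A: "0 < A" using W0 by (simp add: A_def less_le)
  have "isCont M \<xi>\<^sub>0" using M by (simp add: continuous_on_eq_continuous_at)
  moreover have "0 < norm ?m / 8" using nz by simp
  ultimately obtain d where d: "0 < d" "\<And>y. dist y \<xi>\<^sub>0 < d \<Longrightarrow> dist (M y) ?m < norm ?m / 8"
    unfolding continuous_at_eps_delta by blast
  \<comment> \<open>This radius makes the phase at most 1/4, and \<open>R\<^sub>0\<close> leaves an error of at most \<open>norm ?m / 8\<close> in \<open>M\<close>; together they stay below \<open>norm ?m / 2\<close>.\<close>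
  define \<epsilon> where "\<epsilon> = 1 / (16 * pi * ?r)"
  define R\<^sub>0 where "R\<^sub>0 = max 1 (4 * ?r / d)"
  show ?thesis
  proof
    show "0 < norm ?m / 2 * A" using A nz by simp
    show "0 < \<epsilon>" using r by (simp add: \<epsilon>_def)
    show "1 \<le> R\<^sub>0" by (simp add: R\<^sub>0_def)
    fix R x assume R: "R\<^sub>0 \<le> R" and x: "norm (x::'a) \<le> \<epsilon> * R"
    have R0: "0 < R" "4 * ?r / d \<le> R" using R by (auto simp: R\<^sub>0_def)
    have "4 * ?r \<le> R * d" using R0 d(1) by (simp add: field_simps)
    then have "2 * ?r < R * d" using r by linarith
    then have small: "2 * ?r / R < d" using R0(1) by (simp add: field_simps)
    define k where "k z = M (\<xi>\<^sub>0 + (fst z - snd z) /\<^sub>R R) * cis (2 * pi * (((fst z + snd z) /\<^sub>R R) \<bullet> x))" for z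
    have "norm ?m / 2 * (LINT z|lborel. W z) \<le> norm (LINT z|lborel. of_real (W z) * k z)"
    proof (rule norm_integral_near_constant[OF Wi W0])
      have "k \<in> borel_measurable borel" unfolding k_def
        by (intro borel_measurable_continuous_onI continuous_intros continuous_on_compose2[OF M]) auto
      then show "k \<in> borel_measurable lborel" by simp
      fix z assume "W z \<noteq> 0"
      then have uv: "norm (fst z) \<le> ?r" "norm (snd z) \<le> ?r" using Ws by auto
      have "norm ((fst z - snd z) /\<^sub>R R) \<le> 2 * ?r / R"
        using uv R0 norm_triangle_ineq4[of "fst z" "snd z"] by (simp add: divide_simps)
      also have "\<dots> < d" by (rule small)
      finally have 1: "norm (M (\<xi>\<^sub>0 + (fst z - snd z) /\<^sub>R R) - ?m) \<le> norm ?m / 8"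
        using d(2)[of "\<xi>\<^sub>0 + (fst z - snd z) /\<^sub>R R"] by (simp add: dist_norm)
      let ?t = "2 * pi * (((fst z + snd z) /\<^sub>R R) \<bullet> x)"
      have "norm ((fst z + snd z) /\<^sub>R R) \<le> 2 * ?r / R"
        using uv R0 norm_triangle_ineq[of "fst z" "snd z"] by (simp add: divide_simps)
      then have "\<bar>((fst z + snd z) /\<^sub>R R) \<bullet> x\<bar> \<le> (2 * ?r / R) * (\<epsilon> * R)"
        using x R0 by (intro order_trans[OF Cauchy_Schwarz_ineq2] mult_mono) auto
      also have "\<dots> = 1 / (8 * pi)" using R0 r by (simp add: \<epsilon>_def)
      finally have "\<bar>?t\<bar> \<le> 2 * pi * (1 / (8 * pi))"
        by (simp only: abs_mult) (intro mult_mono, auto)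
      then have 2: "norm (cis ?t - 1) \<le> 1 / 4" using norm_cis_minus_1_le[of ?t] by simp
      have "k z - ?m = (M (\<xi>\<^sub>0 + (fst z - snd z) /\<^sub>R R) - ?m) * cis ?t + ?m * (cis ?t - 1)"
        by (simp add: k_def algebra_simps)
      also have "norm \<dots> \<le> norm (M (\<xi>\<^sub>0 + (fst z - snd z) /\<^sub>R R) - ?m) + norm ?m * norm (cis ?t - 1)"
        by (rule order_trans[OF norm_triangle_ineq]) (simp add: norm_mult)
      also have "\<dots> \<le> norm ?m / 8 + norm ?m * (1 / 4)"
        by (intro add_mono 1 mult_left_mono 2) auto
      also have "\<dots> \<le> norm ?m / 2" by simp
      finally show "norm (k z - ?m) \<le> norm ?m / 2" .
    qed
    then show "norm ?m / 2 * A \<le> norm (bilinear_mult M (packet_hat \<xi>\<^sub>0 R) (packet_hat 0 R) x)"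
      unfolding bilinear_mult_packets[OF M R0(1)] by (simp add: A_def W_def k_def)
  qed
qed

section \<open>Comparison of growth rates\<close>

lemma powr_exponent_le:
  fixes K L s t :: real
  assumes "0 < K" "\<And>R. R\<^sub>0 \<le> R \<Longrightarrow> K * R powr s \<le> L * R powr t"
  shows "s \<le> t"
proof (rule ccontr)
  assume "\<not> s \<le> t"
  then have st: "0 < s - t" by simp
  let ?Q = "\<bar>L\<bar> / K + 1"
  define R where "R = max (max 1 R\<^sub>0) (?Q powr (1 / (s - t)))"
  have Q: "0 < ?Q" using assms(1) by (simp add: add_nonneg_pos)
  have R: "0 < R" "R\<^sub>0 \<le> R" "?Q powr (1 / (s - t)) \<le> R" by (auto simp: R_def)
  have "?Q = (?Q powr (1 / (s - t))) powr (s - t)" using st Q by (simp add: powr_powr)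
  also have "\<dots> \<le> R powr (s - t)" using st R by (intro powr_mono2) auto
  finally have "L / K < R powr (s - t)"
    using assms(1) divide_right_mono[of L "\<bar>L\<bar>" K] by linarith
  then have "L * R powr t < K * R powr (s - t) * R powr t"
    using R(1) assms(1) by (intro mult_strict_right_mono) (auto simp: field_simps)
  also have "\<dots> = K * R powr s" by (simp add: mult.assoc powr_add[symmetric])
  also have "\<dots> \<le> L * R powr t" using R(2) by (rule assms(2))
  finally show False by simp
qed

text \<open>
  Raising the integral to at least 1 ensures that the volume in \<open>lux_upper\<close> is at least 1.
\<close>

lemma packet_norm_upper:
  fixes \<xi>\<^sub>0 :: "'a::euclidean_space"
  assumes p: "exponent_ge_1 p" "infinity_set p \<in> null_sets lebesgue"
    and a: "1 \<le> a" "AE x in lebesgue. ennreal a \<le> p x"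
    and R: "1 \<le> R"
  defines "I \<equiv> max 1 (LINT x|lborel. fejer_prod (x::'a))"
  shows "packet \<xi>\<^sub>0 R \<in> var_Lp p" "0 \<le> var_Lp_norm p (packet \<xi>\<^sub>0 R)"
    "var_Lp_norm p (packet \<xi>\<^sub>0 R) \<le> I powr (1/a) * R powr (DIM('a) / a)"
proof -
  have R0: "0 < R" using R by simp
  note pk = packet_integral[OF R0, of \<xi>\<^sub>0]
  have m: "packet \<xi>\<^sub>0 R \<in> borel_measurable lebesgue" by (intro measurable_completion) simp
  have n1: "norm (packet \<xi>\<^sub>0 R x) \<le> 1" for x by (simp add: norm_packet fejer_prod_le_1)
  have "(\<integral>\<^sup>+ x. ennreal (norm (packet \<xi>\<^sub>0 R x)) \<partial>lebesgue)
      = ennreal (R ^ DIM('a) * (LINT x|lborel. fejer_prod (x::'a)))"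
    using pk by (simp add: nn_integral_completion has_bochner_integral_iff nn_integral_eq_integral)
  also have "\<dots> \<le> ennreal (I * R ^ DIM('a))"
    using R by (intro ennreal_leI) (simp add: I_def mult.commute)
  finally have V: "(\<integral>\<^sup>+ x. ennreal (norm (packet \<xi>\<^sub>0 R x)) \<partial>lebesgue) \<le> ennreal (I * R ^ DIM('a))" .
  have "1 * 1 \<le> I * R ^ DIM('a)" using R by (intro mult_mono) (auto simp: I_def)
  then have V1: "1 \<le> I * R ^ DIM('a)" by simp
  note up = lux_upper[OF p(2) m a n1 V1 V]
  have "(I * R ^ DIM('a)) powr (1/a) = I powr (1/a) * R powr (DIM('a) / a)"
    using R by (simp add: powr_mult powr_powr flip: powr_realpow)
  with up p(1) show "packet \<xi>\<^sub>0 R \<in> var_Lp p" "0 \<le> var_Lp_norm p (packet \<xi>\<^sub>0 R)"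
    "var_Lp_norm p (packet \<xi>\<^sub>0 R) \<le> I powr (1/a) * R powr (DIM('a) / a)"
    by (simp_all add: var_Lp_def var_Lp_norm_def)
qed

lemma not_AE_lebesgue_False: "\<not> (AE x::'a::euclidean_space in lebesgue. False)"
proof
  assume "AE x::'a in lebesgue. False"
  then have "emeasure lebesgue (UNIV :: 'a set) = 0"
    by (subst (asm) AE_iff_measurable[of UNIV]) auto
  then show False by simp
qed

lemma essinf_real:
  fixes p :: "'a::euclidean_space \<Rightarrow> ennreal"
  assumes "exponent_ge_1 p" "infinity_set p \<in> null_sets lebesgue"
  obtains a where "1 \<le> a" "essinf lebesgue p = ennreal a"
proof -
  let ?a = "essinf lebesgue p"
  have "AE x in lebesgue. x \<notin> infinity_set p" using assms(2) by (rule AE_not_in)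
  moreover have "AE x in lebesgue. ?a \<le> p x" by (rule AE_essinf_le)
  ultimately have "AE x in lebesgue. p x \<noteq> \<infinity> \<and> ?a \<le> p x"
    by eventually_elim (simp add: infinity_set_def)
  then have "AE x::'a in lebesgue. False" if "?a = \<infinity>"
    using that by (simp add: top_unique)
  then have "?a \<noteq> \<infinity>" using not_AE_lebesgue_False by blast
  then obtain a where a: "0 \<le> a" "?a = ennreal a" by (cases ?a) auto
  have "1 \<le> ?a" unfolding essinf_def using assms(1)
    by (intro Sup_upper) (simp add: exponent_ge_1_def)
  then have "1 \<le> a" using a by (simp add: ennreal_1[symmetric] del: ennreal_1)
  with a show ?thesis using that by blast
qed

text \<open>
  Inserting the packets into the boundedness of \<open>B\<^sub>M\<close> compares two powers of \<open>R\<close>. Real bounds for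
  the exponents are used so that infinite values are dealt with separately.
\<close>

lemma multiplier_exponents:
  fixes p1 p2 p3 :: "'a::euclidean_space \<Rightarrow> ennreal"
    and M :: "'a \<Rightarrow> complex"
  assumes p: "exponent_ge_1 p1" "exponent_ge_1 p2" "exponent_ge_1 p3 \<or> exponent_P0 p3"
    and null: "infinity_set p1 \<in> null_sets lebesgue" "infinity_set p2 \<in> null_sets lebesgue"
        "infinity_set p3 \<in> null_sets lebesgue"
    and M: "continuous_on UNIV M" "M \<xi>\<^sub>0 \<noteq> 0" "M \<in> BM_tilde p1 p2 p3"
    and a: "1 \<le> a" "AE x in lebesgue. ennreal a \<le> p1 x"
    and b: "1 \<le> b" "AE x in lebesgue. ennreal b \<le> p2 x"
    and P: "0 < P" "AE x in lebesgue. p3 x \<le> ennreal P"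
  shows "1 / P \<le> 1 / a + 1 / b"
proof -
  let ?n = "real DIM('a)"
  obtain C where C: "C > 0" and bd: "\<And>f g F G. f \<in> var_Lp p1 \<Longrightarrow> g \<in> var_Lp p2 \<Longrightarrow>
        fourier_L2 f F \<Longrightarrow> bounded_compact_support F \<Longrightarrow>
        fourier_L2 g G \<Longrightarrow> bounded_compact_support G \<Longrightarrow>
          bilinear_mult M F G \<in> var_Lp p3 \<and>
          var_Lp_norm p3 (bilinear_mult M F G) \<le> C * var_Lp_norm p1 f * var_Lp_norm p2 g"
    using M(3) unfolding BM_tilde_def by blast
  obtain \<delta> \<epsilon> R\<^sub>0 where low: "0 < \<delta>" "0 < \<epsilon>" "1 \<le> R\<^sub>0"
    "\<And>R x. R\<^sub>0 \<le> R \<Longrightarrow> norm x \<le> \<epsilon> * R \<Longrightarrow>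
       \<delta> \<le> norm (bilinear_mult M (packet_hat \<xi>\<^sub>0 R) (packet_hat 0 R) x)"
    using bilinear_mult_lower[OF M(1,2)] by blast
  define v where "v = unit_ball_vol ?n * \<epsilon> ^ DIM('a)"
  have v: "0 < v" using low by (simp add: v_def)
  define I where "I = max 1 (LINT x|lborel. fejer_prod (x::'a))"
  \<comment> \<open>From \<open>2 / v\<close> on, the ball of radius \<open>\<epsilon> R\<close> has measure larger than 1.\<close>
  define R\<^sub>1 where "R\<^sub>1 = max R\<^sub>0 (2 / v)"
  have "?n / P \<le> ?n / a + ?n / b"
  proof (rule powr_exponent_le)
    show "0 < \<delta> * v powr (1/P)" using low v by simp
    fix R assume R: "R\<^sub>1 \<le> R"
    then have R': "1 \<le> R" "0 < R" "R\<^sub>0 \<le> R" "2 / v \<le> R" using low by (auto simp: R\<^sub>1_def)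
    let ?B = "bilinear_mult M (packet_hat \<xi>\<^sub>0 R) (packet_hat 0 R)"
    note f = packet_norm_upper[OF p(1) null(1) a R'(1), of \<xi>\<^sub>0, folded I_def]
    note g = packet_norm_upper[OF p(2) null(2) b R'(1), of 0, folded I_def]
    have B: "?B \<in> var_Lp p3" "var_Lp_norm p3 ?B
        \<le> C * var_Lp_norm p1 (packet \<xi>\<^sub>0 R) * var_Lp_norm p2 (packet 0 R)"
      using bd[OF f(1) g(1) fourier_L2_packet[OF R'(2)] bounded_compact_support_packet_hat[OF R'(2)]
        fourier_L2_packet[OF R'(2)] bounded_compact_support_packet_hat[OF R'(2)]] by auto
    let ?E = "ball (0::'a) (\<epsilon> * R)"
    have E: "emeasure lebesgue ?E = ennreal (v * R ^ DIM('a))"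
      using low R' by (simp add: emeasure_ball v_def power_mult_distrib mult.assoc)
    have "2 \<le> v * R" using R'(4) v by (simp add: field_simps)
    also have "\<dots> \<le> v * R ^ DIM('a)" using v R'(1) by (intro mult_left_mono self_le_power) auto
    finally have V: "1 < v * R ^ DIM('a)" by simp
    have Rn: "(R ^ DIM('a)) powr (1/P) = R powr (?n / P)"
      using R' by (simp add: powr_powr flip: powr_realpow)
    have "\<delta> * (v * R ^ DIM('a)) powr (1/P) \<le> var_Lp_norm p3 ?B"
      by (rule var_Lp_norm_lower[OF p(3) null(3) P B(1) _ E V low(1)])
        (auto intro!: low(4) R'(3))
    also have "\<dots> \<le> C * var_Lp_norm p1 (packet \<xi>\<^sub>0 R) * var_Lp_norm p2 (packet 0 R)" by (rule B)
    also have "\<dots> \<le> C * (I powr (1/a) * R powr (?n / a)) * (I powr (1/b) * R powr (?n / b))"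
      using C f(2,3) g(2,3) by (intro mult_mono) auto
    finally show "\<delta> * v powr (1/P) * R powr (?n / P)
      \<le> C * (I powr (1/a) * I powr (1/b)) * R powr (?n / a + ?n / b)"
      by (simp add: powr_mult Rn powr_add mult_ac)
  qed
  then have "?n * (1 / P) \<le> ?n * (1 / a + 1 / b)" by (simp add: distrib_left)
  then show ?thesis by (rule mult_left_le_imp_le) simp
qed

theorem theorem2p8:
  fixes p1 p2 p3 :: "real ^ 'n \<Rightarrow> ennreal"
    and M :: "real ^ 'n \<Rightarrow> complex"
  assumes "exponent_ge_1 p1"
    and "exponent_ge_1 p2"
    and "p3 \<in> borel_measurable lebesgue"
    and "\<And>x. 0 < p3 x"
    and "exponent_ge_1 p3 \<or> exponent_P0 p3"
    and "infinity_set p1 \<in> null_sets lebesgue"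
    and "infinity_set p2 \<in> null_sets lebesgue"
    and "infinity_set p3 \<in> null_sets lebesgue"
    and "continuous_on UNIV M"
    and "integrable lebesgue M"
    and "\<exists>\<xi>. M \<xi> \<noteq> 0"
    and "M \<in> BM_tilde p1 p2 p3"
  shows "1 / esssup lebesgue p3 \<le> 1 / essinf lebesgue p1 + 1 / essinf lebesgue p2"
proof -
  obtain a where a: "1 \<le> a" "essinf lebesgue p1 = ennreal a"
    using essinf_real[OF assms(1,6)] .
  obtain b where b: "1 \<le> b" "essinf lebesgue p2 = ennreal b"
    using essinf_real[OF assms(2,7)] .
  obtain \<xi>\<^sub>0 where \<xi>\<^sub>0: "M \<xi>\<^sub>0 \<noteq> 0" using assms(11) by blast
  let ?P = "esssup lebesgue p3"
  show ?thesis
  proof (cases "?P = \<infinity>")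
    case True
    then show ?thesis by simp
  next
    case False
    then obtain P where P: "0 \<le> P" "?P = ennreal P" by (cases ?P) auto
    have AEP: "AE x in lebesgue. p3 x \<le> ennreal P"
      using esssup_AE[of p3 lebesgue] P by simp
    have "P \<noteq> 0"
    proof
      assume "P = 0"
      with AEP have "AE x::real^'n in lebesgue. False"
        using assms(4) by (auto elim!: eventually_mono simp: not_le[symmetric])
      then show False using not_AE_lebesgue_False by blast
    qed
    then have P0: "0 < P" using P by simp
    have "1 / P \<le> 1 / a + 1 / b"
      using AE_essinf_le[of lebesgue p1] AE_essinf_le[of lebesgue p2]
      unfolding a b
      by (intro multiplier_exponents[OF assms(1,2,5,6,7,8,9) \<xi>\<^sub>0 assms(12) a(1) _ b(1) _ P0 AEP])
    then have "ennreal (1 / P) \<le> ennreal (1 / a) + ennreal (1 / b)"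
      using a b by (simp add: ennreal_plus[symmetric] ennreal_leI del: ennreal_plus)
    moreover have "1 / ennreal t = ennreal (1 / t)" if "0 < t" for t
      using that divide_ennreal[of 1 t] by simp
    ultimately show ?thesis using P0 a b P by simp
  qed
qed

end
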